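(* There are infinitely many solutions in positive integers $(a,b,c,d,e,f)$ of the system $$a^2+b^2=c^2,\qquad d^2=e^2+ab,\qquad f^2=d^2+ab.$$ Moreover, there are infinitely many pairwise dissimilar (i.e. pairwise non-similar) non-trivial perfect hexahedra in $\mathbf{R}^3$ with two congruent rectangular opposite parallel faces and four congruent trapezoidal faces.
   Context: A perfect hexahedron (of the type considered here) is a six-sided polyhedron in $\mathbf{R}^3$ constructed as follows. Take two congruent rectangles with side lengths $a,b$, placed in parallel planes at distance $h$, with the line through their centers perpendicular to both planes, and with one rectangle rotated by ninety degrees relative to the other. Explicitly, the bottom rectangle has vertices $(\pm\frac a2,\pm\frac b2,0)$ and the top rectangle has vertices $(\pm\frac b2,\pm\frac a2,h)$. The sides of the two rectangles are connected by four congruent trapezoids, each having as parallel sides a side of length $a$ of one rectangle and the corresponding parallel side of length $b$ of the other. One requires that all the following lengths be positive integers: the edges $a,b$ of the rectangles, the diagonal $c$ of the rectangles, the slant side $e$ and the diagonal $d$ of the trapezoids, and the interior (space) diagonal $f$ of the solid. These lengths satisfy $a^2+b^2=c^2$, $d^2=e^2+ab$, $f^2=d^2+ab$, and the height satisfies $a^2+b^2+2h^2=2d^2$. Non-trivial means that the solid is non-degenerate, i.e. $a,b>0$ and $h>0$. *)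

theory Defs
  imports "HOL-Analysis.Analysis"
begin

text \<open>A map scaling all distances of \<open>real^3\<close> by a fixed positive ratio is automatically a
  bijective affine map; orientation-reversing maps are allowed.\<close>

definition similarity_map :: "real \<Rightarrow> (real^3 \<Rightarrow> real^3) \<Rightarrow> bool" where
  "similarity_map r g \<longleftrightarrow> r > 0 \<and> (\<forall>x y. dist (g x) (g y) = r * dist x y)"

definition similar_sets :: "(real^3) set \<Rightarrow> (real^3) set \<Rightarrow> bool" where
  "similar_sets P Q \<longleftrightarrow> (\<exists>r g. similarity_map r g \<and> g ` P = Q)"

definition congruent_sets :: "(real^3) set \<Rightarrow> (real^3) set \<Rightarrow> bool" where
  "congruent_sets P Q \<longleftrightarrow> (\<exists>g. similarity_map 1 g \<and> g ` P = Q)"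

definition rectangle :: "(real^3) set \<Rightarrow> bool" where
  "rectangle R \<longleftrightarrow>
     (\<exists>p u v. u \<noteq> 0 \<and> v \<noteq> 0 \<and> orthogonal u v \<and> R = convex hull {p, p + u, p + v, p + u + v})"

text \<open>The parallel sides are \<open>[p, p + u]\<close> and \<open>[q, q + k u]\<close>; since \<open>k \<noteq> 1\<close>,
  parallelograms are not counted as trapezoids.\<close>

definition trapezoid :: "(real^3) set \<Rightarrow> bool" where
  "trapezoid T \<longleftrightarrow>
     (\<exists>p q u k. \<not> collinear {p, p + u, q} \<and> k > 0 \<and> k \<noteq> 1 \<and>
        T = convex hull {p, p + u, q, q + k *\<^sub>R u})"

definition two_rectangles_four_trapezoids :: "(real^3) set \<Rightarrow> bool" where
  "two_rectangles_four_trapezoids P \<longleftrightarrow>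
     polytope P \<and> aff_dim P = 3 \<and>
     (\<exists>R1 R2 \<T>. {F. F facet_of P} = {R1, R2} \<union> \<T> \<and>
        rectangle R1 \<and> rectangle R2 \<and> congruent_sets R1 R2 \<and>
        R1 \<inter> R2 = {} \<and> affine_parallel (affine hull R1) (affine hull R2) \<and>
        card \<T> = 4 \<and> (\<forall>T\<in>\<T>. trapezoid T) \<and> (\<forall>S\<in>\<T>. \<forall>T\<in>\<T>. congruent_sets S T))"

text \<open>The vertices of an axis-parallel \<open>l \<times> w\<close> rectangle at height \<open>z\<close>, centred on the
  third axis, are obtained for signs \<open>s, t \<in> {-1, 1}\<close>.\<close>

definition rect_vertex :: "real \<Rightarrow> real \<Rightarrow> real \<Rightarrow> real \<Rightarrow> real \<Rightarrow> real^3" where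
  "rect_vertex l w z s t = vector [s * l / 2, t * w / 2, z]"

definition hexahedron :: "real \<Rightarrow> real \<Rightarrow> real \<Rightarrow> (real^3) set" where
  "hexahedron a b h = convex hull
     ({rect_vertex a b 0 s t | s t. s \<in> {-1, 1} \<and> t \<in> {-1, 1}} \<union>
      {rect_vertex b a h s t | s t. s \<in> {-1, 1} \<and> t \<in> {-1, 1}})"

text \<open>The equations below cover the distances between all pairs of vertices. For a bottom vertex
  with signs \<open>(s, t)\<close>, the top vertex with the same signs is joined to it by a slant edge, those
  with exactly one sign changed are opposite to it in a trapezoid, and the one with both signs
  changed is opposite to it in the solid.\<close>

definition nontrivial_perfect_hexahedron :: "(real^3) set \<Rightarrow> bool" where
  "nontrivial_perfect_hexahedron P \<longleftrightarrow>
     (\<exists>(a::nat) (b::nat) (c::nat) (d::nat) (e::nat) (f::nat) (h::real).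
        a > 0 \<and> b > 0 \<and> c > 0 \<and> d > 0 \<and> e > 0 \<and> f > 0 \<and> h > 0 \<and>
        P = hexahedron (real a) (real b) h \<and>
        (let B = rect_vertex (real a) (real b) 0; T = rect_vertex (real b) (real a) h in
         \<forall>s\<in>{-1, 1}. \<forall>t\<in>{-1, 1}.
           dist (B s t) (B (-s) t) = real a \<and> dist (B s t) (B s (-t)) = real b \<and>
           dist (T s t) (T (-s) t) = real b \<and> dist (T s t) (T s (-t)) = real a \<and>
           dist (B s t) (B (-s) (-t)) = real c \<and> dist (T s t) (T (-s) (-t)) = real c \<and>
           dist (B s t) (T s t) = real e \<and>
           dist (B s t) (T (-s) t) = real d \<and> dist (B s t) (T s (-t)) = real d \<and>
           dist (B s t) (T (-s) (-t)) = real f))"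

end

theory Submission
  imports Defs
begin

text \<open>
  The legs of the right triangle \<open>(8, 15, 17)\<close> have product \<open>120\<close>, and \<open>7\<^sup>2, 13\<^sup>2, 17\<^sup>2\<close> is an arithmetic
  progression with difference \<open>120\<close>; thus \<open>(8, 15, 17, 13, 7, 17)\<close> is a solution. Keep the shape of
  the rectangle, scale it by \<open>s\<close>, and look for further progressions of squares with difference
  \<open>120 * s\<^sup>2\<close>. They correspond to rational points on the elliptic curve \<open>y\<^sup>2 = x\<^sup>3 - 120\<^sup>2 * x\<close>, and
  doubling a point gives a new progression (\<open>square_progression_doubling\<close>). Each doubling keeps
  \<open>d, e, f\<close> odd and adds exactly one factor of two to \<open>s\<close>, so that all these solutions differ, even
  up to scaling.

  A solution belongs to a solid of positive height only if \<open>289 * s\<^sup>2 < 2 * d\<^sup>2\<close>. Doubling may destroy this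
  inequality; but when it fails, \<open>d\<^sup>2 / s\<^sup>2\<close> is so close to its lower bound \<open>120\<close>, a pole of the
  duplication map, that the next doubling restores it (\<open>height_recovers\<close>). Infinitely many of the
  solutions are therefore geometric (\<open>infinite_tall_levels\<close>).

  The combinatorial structure of the solid comes from its description by six inequalities
  (\<open>hexahedron_eq_halfspaces\<close>), each of them indispensable. The facets are then the six sections of the
  solid by the bounding planes, and every section is the convex hull of the four vertices that it contains
  (\<open>facets_of_hexahedron\<close>). The symmetries of the solid supply the congruences between the faces.

  Similar solids are recognised by their extreme points, which a map that scales distances must
  preserve. The distances between the extreme points of a solid in the family are integers, and
  the largest exponent of two in a ratio of two of them counts the doublings
  (\<open>similar_imp_same_level\<close>). Hence solids from different doublings are not similar.
\<close>

section \<open>Progressions of squares by doubling\<close>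

text \<open>A rational solution \<open>8, 15, 17, d / s, e / s, f / s\<close> with its denominator cleared. The index \<open>n\<close>
  is the exact exponent of two in \<open>s\<close>; it serves to tell solutions, and later solids, apart.\<close>

definition scaled_solution :: "nat \<Rightarrow> nat \<Rightarrow> nat \<Rightarrow> nat \<Rightarrow> nat \<Rightarrow> bool" where
  "scaled_solution n s d e f \<longleftrightarrow>
     (\<exists>m. odd m \<and> s = 2 ^ n * m) \<and> odd d \<and> odd e \<and> odd f \<and>
     d\<^sup>2 = e\<^sup>2 + 120 * s\<^sup>2 \<and> f\<^sup>2 = d\<^sup>2 + 120 * s\<^sup>2"

lemma scaled_solution_start: "scaled_solution 0 1 13 7 17"
  by (simp add: scaled_solution_def)

text \<open>The squares \<open>d\<^sup>2 - N, d\<^sup>2, d\<^sup>2 + N\<close> put the point \<open>(d\<^sup>2, d * e * f)\<close> on the elliptic curve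
  \<open>y\<^sup>2 = x\<^sup>3 - N\<^sup>2 * x\<close>. The double of that point has first coordinate
  \<open>((d ^ 4 + N\<^sup>2) / (2 * d * e * f))\<^sup>2\<close>, which is again the middle term of a progression of squares
  with difference \<open>N\<close>; the formulas below are this fact with denominators cleared.\<close>

lemma square_progression_doubling:
  fixes d e f N :: int
  assumes "d\<^sup>2 = e\<^sup>2 + N" and "f\<^sup>2 = d\<^sup>2 + N"
  shows "(d ^ 4 + N\<^sup>2)\<^sup>2 = (d ^ 4 - 2 * N * d\<^sup>2 - N\<^sup>2)\<^sup>2 + N * (2 * d * e * f)\<^sup>2"
    and "(d ^ 4 + 2 * N * d\<^sup>2 - N\<^sup>2)\<^sup>2 = (d ^ 4 + N\<^sup>2)\<^sup>2 + N * (2 * d * e * f)\<^sup>2"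
proof -
  define D where "D = d\<^sup>2"
  have d4: "d ^ 4 = D\<^sup>2"
    by (simp add: D_def flip: power_mult)
  have e: "e\<^sup>2 = D - N" and f: "f\<^sup>2 = D + N"
    using assms by (simp_all add: D_def)
  have *: "(2 * d * e * f)\<^sup>2 = 4 * D * (D - N) * (D + N)"
    by (simp add: power_mult_distrib e f D_def)
  show "(d ^ 4 + N\<^sup>2)\<^sup>2 = (d ^ 4 - 2 * N * d\<^sup>2 - N\<^sup>2)\<^sup>2 + N * (2 * d * e * f)\<^sup>2"
    unfolding * d4 D_def[symmetric] by algebra
  show "(d ^ 4 + 2 * N * d\<^sup>2 - N\<^sup>2)\<^sup>2 = (d ^ 4 + N\<^sup>2)\<^sup>2 + N * (2 * d * e * f)\<^sup>2"
    unfolding * d4 D_def[symmetric] by algebra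
qed

text \<open>With \<open>A = d\<^sup>2\<close> and \<open>B = s\<^sup>2\<close>, the conclusion says that doubling leads to
  \<open>289 * s'\<^sup>2 < 2 * d'\<^sup>2\<close>. If the height condition fails then \<open>A / B\<close> lies between \<open>120\<close> and \<open>144.5\<close>. The
  duplication map has a pole at \<open>120\<close> and is decreasing next to it, so that it sends this whole
  interval far above \<open>144.5\<close>; crude bounds at the two endpoints are enough.\<close>

lemma height_recovers:
  fixes A B :: int
  assumes "0 \<le> B" and "120 * B < A" and "2 * A \<le> 289 * B"
  shows "1156 * A * B * (A\<^sup>2 - 14400 * B\<^sup>2) < 2 * (A\<^sup>2 + 14400 * B\<^sup>2)\<^sup>2"
proof -
  have B: "0 < B" using assms by linarith
  have A: "0 < A" using assms B by linarith
  have "(120 * B)\<^sup>2 < A\<^sup>2"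
    using assms by (intro power_strict_mono) auto
  hence lower: "14400 * B\<^sup>2 < A\<^sup>2"
    by (simp add: power_mult_distrib)
  have "(2 * A)\<^sup>2 \<le> (289 * B)\<^sup>2"
    using assms A by (intro power_mono) auto
  hence "4 * A\<^sup>2 \<le> 83521 * B\<^sup>2"
    by (simp add: power_mult_distrib)
  hence upper: "A\<^sup>2 - 14400 * B\<^sup>2 \<le> 6481 * B\<^sup>2"
    using zero_le_power2[of B] by linarith
  have "2 * A * B \<le> 289 * B * B"
    using assms B by (intro mult_right_mono) auto
  hence "1156 * A * B \<le> 167042 * B\<^sup>2"
    by (simp add: power2_eq_square)
  hence "1156 * A * B * (A\<^sup>2 - 14400 * B\<^sup>2) \<le> 167042 * B\<^sup>2 * (6481 * B\<^sup>2)"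
    using upper lower by (intro mult_mono[where c = "A\<^sup>2 - 14400 * B\<^sup>2"]) auto
  \<comment> \<open>\<open>28800 * B\<^sup>2\<close> is the value of \<open>A\<^sup>2 + 14400 * B\<^sup>2\<close> at the pole \<open>A = 120 * B\<close>.\<close>
  also have "\<dots> < 2 * (28800 * B\<^sup>2)\<^sup>2"
    using B by (simp add: power_mult_distrib flip: power2_eq_square)
  also have "\<dots> \<le> 2 * (A\<^sup>2 + 14400 * B\<^sup>2)\<^sup>2"
    using lower B by (intro mult_left_mono power_mono) auto
  finally show ?thesis .
qed

lemma scaled_solution_step:
  assumes "scaled_solution n s d e f"
  obtains s' d' e' f' where "scaled_solution (Suc n) s' d' e' f'"
    and "2 * d\<^sup>2 \<le> 289 * s\<^sup>2 \<Longrightarrow> 289 * s'\<^sup>2 < 2 * d'\<^sup>2"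
proof -
  obtain m where m: "odd m" "s = 2 ^ n * m" and odd: "odd d" "odd e" "odd f"
    and de: "d\<^sup>2 = e\<^sup>2 + 120 * s\<^sup>2" and df: "f\<^sup>2 = d\<^sup>2 + 120 * s\<^sup>2"
    using assms by (auto simp: scaled_solution_def)
  define N where "N = 120 * (int s)\<^sup>2"
  have N: "int d ^ 2 = int e ^ 2 + N" "int f ^ 2 = int d ^ 2 + N"
    using arg_cong[OF de, of int] arg_cong[OF df, of int] by (simp_all add: N_def)
  have evenN: "even N" by (simp add: N_def)
  define s' where "s' = 2 * d * e * f * s"
  define d' where "d' = nat \<bar>int d ^ 4 + N\<^sup>2\<bar>"
  define e' where "e' = nat \<bar>int d ^ 4 - 2 * N * (int d)\<^sup>2 - N\<^sup>2\<bar>"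
  define f' where "f' = nat \<bar>int d ^ 4 + 2 * N * (int d)\<^sup>2 - N\<^sup>2\<bar>"
  have d'sq: "(int d')\<^sup>2 = (int d ^ 4 + N\<^sup>2)\<^sup>2"
    and e'sq: "(int e')\<^sup>2 = (int d ^ 4 - 2 * N * (int d)\<^sup>2 - N\<^sup>2)\<^sup>2"
    and f'sq: "(int f')\<^sup>2 = (int d ^ 4 + 2 * N * (int d)\<^sup>2 - N\<^sup>2)\<^sup>2"
    by (simp_all add: d'_def e'_def f'_def)
  have s'sq: "120 * (int s')\<^sup>2 = N * (2 * int d * int e * int f)\<^sup>2"
    by (simp add: s'_def N_def power_mult_distrib)
  have "int (d'\<^sup>2) = int (e'\<^sup>2 + 120 * s'\<^sup>2)" "int (f'\<^sup>2) = int (d'\<^sup>2 + 120 * s'\<^sup>2)"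
    using square_progression_doubling[OF N] by (simp_all add: d'sq e'sq f'sq s'sq)
  hence prog: "d'\<^sup>2 = e'\<^sup>2 + 120 * s'\<^sup>2" "f'\<^sup>2 = d'\<^sup>2 + 120 * s'\<^sup>2"
    by (metis of_nat_eq_iff)+
  \<comment> \<open>As \<open>N\<close> is even, each new entry is congruent to \<open>d ^ 4\<close> modulo two, and \<open>s'\<close> has gained exactly one
    factor of two.\<close>
  have odd': "odd d'" "odd e'" "odd f'"
    using odd evenN by (simp_all add: d'_def e'_def f'_def even_nat_iff)
  have "odd (d * e * f * m)" "s' = 2 ^ Suc n * (d * e * f * m)"
    using odd m by (simp_all add: s'_def)
  hence *: "scaled_solution (Suc n) s' d' e' f'"
    using odd' prog unfolding scaled_solution_def by blast
  moreover have "289 * s'\<^sup>2 < 2 * d'\<^sup>2" if small: "2 * d\<^sup>2 \<le> 289 * s\<^sup>2"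
  proof -
    define A B where "A = (int d)\<^sup>2" and "B = (int s)\<^sup>2"
    have "int e \<noteq> 0" using odd by (auto intro: Nat.gr0I)
    hence "120 * B < A" using N by (simp add: A_def B_def N_def)
    moreover have "2 * A \<le> 289 * B"
    proof -
      have "int (2 * d\<^sup>2) \<le> int (289 * s\<^sup>2)" using small by linarith
      thus ?thesis by (simp add: A_def B_def)
    qed
    ultimately have "1156 * A * B * (A\<^sup>2 - 14400 * B\<^sup>2) < 2 * (A\<^sup>2 + 14400 * B\<^sup>2)\<^sup>2"
      by (intro height_recovers) (simp_all add: B_def)
    moreover have "289 * (int s')\<^sup>2 = 1156 * A * B * (A\<^sup>2 - 14400 * B\<^sup>2)"
    proof -
      have "(int e)\<^sup>2 * (int f)\<^sup>2 = (A - 120 * B) * (A + 120 * B)"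
        using N by (simp add: A_def B_def N_def)
      hence "(int s')\<^sup>2 = 4 * A * ((A - 120 * B) * (A + 120 * B)) * B"
        by (simp only: s'_def of_nat_mult of_nat_numeral power_mult_distrib A_def B_def) simp
      thus ?thesis by (simp add: power2_eq_square algebra_simps)
    qed
    moreover have "(int d')\<^sup>2 = (A\<^sup>2 + 14400 * B\<^sup>2)\<^sup>2"
      by (simp add: d'sq N_def A_def B_def power_mult_distrib)
    ultimately have "int (289 * s'\<^sup>2) < int (2 * d'\<^sup>2)" by simp
    thus ?thesis by linarith
  qed
  ultimately show thesis using that by blast
qed

text \<open>Among two consecutive levels at least one satisfies the height condition, so that the chain of
  doublings of \<open>(13, 7, 17)\<close> meets it infinitely often.\<close>

lemma infinite_tall_levels:
  "infinite {n. \<exists>s d e f. scaled_solution n s d e f \<and> 289 * s\<^sup>2 < 2 * d\<^sup>2}" (is "infinite ?A")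
  unfolding infinite_nat_iff_unbounded_le
proof
  fix n
  have "\<exists>s d e f. scaled_solution n s d e f"
  proof (induction n)
    case 0
    show ?case using scaled_solution_start by blast
  next
    case (Suc n)
    thus ?case by (metis scaled_solution_step)
  qed
  then obtain s d e f where "scaled_solution n s d e f" by blast
  then obtain k where "k \<in> {n, Suc n}" "\<exists>s d e f. scaled_solution k s d e f \<and> 289 * s\<^sup>2 < 2 * d\<^sup>2"
    by (metis scaled_solution_step insertI1 insertI2 not_le)
  thus "\<exists>k\<ge>n. k \<in> ?A" by (intro exI[of _ k]) auto
qed

lemma scaled_solution_pos:
  assumes "scaled_solution n s d e f"
  shows "s > 0" "d > 0" "e > 0" "f > 0"
  using assms by (auto simp: scaled_solution_def intro!: Nat.gr0I)

lemma scaled_solution_equations: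
  assumes "scaled_solution n s d e f"
  shows "(8 * s)\<^sup>2 + (15 * s)\<^sup>2 = (17 * s)\<^sup>2"
    "d\<^sup>2 = e\<^sup>2 + 8 * s * (15 * s)" "f\<^sup>2 = d\<^sup>2 + 8 * s * (15 * s)"
  using assms by (simp_all add: scaled_solution_def power2_eq_square)

text \<open>Among all the lengths, \<open>8 * s\<close> contains the highest power of two, namely \<open>2 ^ (n + 3)\<close>.\<close>

lemma scaled_solution_dvd:
  assumes "scaled_solution n s d e f" and "x \<in> {8 * s, 15 * s, 17 * s, d, e, f}"
  shows "\<not> 2 ^ (n + 4) dvd x"
proof
  assume dvd: "2 ^ (n + 4) dvd x"
  obtain m where m: "odd m" "s = 2 ^ n * m" and odd: "odd d" "odd e" "odd f"
    using assms(1) by (auto simp: scaled_solution_def)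
  have "even x" using dvd by (metis dvd_trans dvd_power add_gr_0 zero_less_numeral)
  hence "x \<in> {8 * s, 15 * s, 17 * s}" using assms(2) odd by auto
  hence "x = 2 ^ n * (8 * m) \<or> x = 2 ^ n * (15 * m) \<or> x = 2 ^ n * (17 * m)"
    using m by auto
  then obtain k where k: "k \<in> {8, 15, 17}" "x = 2 ^ n * (k * m)"
    by blast
  hence "2 ^ 4 dvd k * m" using dvd by (simp add: power_add)
  moreover have "coprime (2 ^ 4) m"
    using m(1) by (metis coprime_power_left_iff coprime_left_2_iff_odd)
  ultimately have "2 ^ 4 dvd k" by (simp only: coprime_dvd_mult_left_iff)
  thus False using k by auto
qed

section \<open>Facets of polytopes given by halfspaces\<close>

text \<open>A point that violates one inequality and satisfies the others shows that this inequality cannot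
  be dropped, and also that the pair is determined by its halfspace. The facets are therefore cut
  out by exactly the given hyperplanes.\<close>

lemma facet_of_irredundant_halfspaces:
  fixes I :: "('a::euclidean_space \<times> real) set"
  assumes fin: "finite I"
    and S: "S = {x. \<forall>(n, \<beta>)\<in>I. n \<bullet> x \<le> \<beta>}"
    and full: "affine hull S = UNIV"
    and witness: "\<And>n \<beta>. (n, \<beta>) \<in> I \<Longrightarrow>
       \<exists>x. \<beta> < n \<bullet> x \<and> (\<forall>(n', \<beta>')\<in>I - {(n, \<beta>)}. n' \<bullet> x \<le> \<beta>')"
  shows "C facet_of S \<longleftrightarrow> (\<exists>(n, \<beta>)\<in>I. C = S \<inter> {x. n \<bullet> x = \<beta>})"
proof -
  define H where "H = (\<lambda>(n, \<beta>). {x::'a. n \<bullet> x \<le> \<beta>})"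
  \<comment> \<open>\<open>J\<close> recovers normal and bound from the halfspace, as the explicit description of facets wants
    them as functions of the halfspace.\<close>
  define J where "J = the_inv_into I H"
  have inj: "inj_on H I"
  proof (rule inj_onI, rule ccontr)
    fix p q assume pq: "p \<in> I" "q \<in> I" "H p = H q" "p \<noteq> q"
    obtain n \<beta> where p: "p = (n, \<beta>)" by force
    obtain x where "\<beta> < n \<bullet> x" "\<forall>(n', \<beta>')\<in>I - {p}. n' \<bullet> x \<le> \<beta>'"
      using witness pq p by metis
    moreover have "q \<in> I - {p}" using pq by blast
    ultimately have "x \<notin> H p" "x \<in> H q"
      unfolding p by (fastforce simp: H_def)+
    thus False using pq by simp
  qed
  have J: "J (H p) = p" if "p \<in> I" for p
    using inj that by (simp add: J_def the_inv_into_f_f)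
  have "S \<noteq> {}" using full by auto
  have SH: "S = \<Inter> (H ` I)" by (auto simp: S H_def)
  have "C facet_of S \<longleftrightarrow> (\<exists>h. h \<in> H ` I \<and> C = S \<inter> {x. fst (J h) \<bullet> x = snd (J h)})"
  proof (rule facet_of_polyhedron_explicit)
    show "finite (H ` I)" using fin by simp
    show "S = affine hull S \<inter> \<Inter> (H ` I)" using full SH by simp
  next
    fix h assume "h \<in> H ` I"
    then obtain n \<beta> where p: "(n, \<beta>) \<in> I" "h = H (n, \<beta>)" by auto
    obtain x where x: "\<beta> < n \<bullet> x" using witness p by blast
    obtain y where "y \<in> S" using \<open>S \<noteq> {}\<close> by blast
    hence "n \<bullet> y \<le> \<beta>" using p by (auto simp: S)
    hence "n \<noteq> 0" using x by auto
    thus "fst (J h) \<noteq> 0 \<and> h = {x. fst (J h) \<bullet> x \<le> snd (J h)}"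
      using J[OF p(1)] p(2) by (simp add: H_def)
  next
    fix F assume F: "F \<subset> H ` I"
    then obtain n \<beta> where p: "(n, \<beta>) \<in> I" "H (n, \<beta>) \<notin> F" by auto
    obtain x where x: "\<beta> < n \<bullet> x" "\<forall>(n', \<beta>')\<in>I - {(n, \<beta>)}. n' \<bullet> x \<le> \<beta>'"
      using witness p by blast
    have "x \<in> \<Inter>F"
    proof
      fix h assume "h \<in> F"
      then obtain q where q: "q \<in> I" "h = H q" using F by blast
      hence "q \<noteq> (n, \<beta>)" using p \<open>h \<in> F\<close> by auto
      thus "x \<in> h" using q x by (auto simp: H_def)
    qed
    moreover have "x \<notin> S"
    proof
      assume "x \<in> S"
      hence "n \<bullet> x \<le> \<beta>" using p(1) by (auto simp: S)
      thus False using x(1) by simp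
    qed
    moreover have "S \<subseteq> \<Inter>F" using SH F by blast
    ultimately show "S \<subset> affine hull S \<inter> \<Inter>F" using full by auto
  qed
  also have "\<dots> \<longleftrightarrow> (\<exists>p\<in>I. C = S \<inter> {x. fst p \<bullet> x = snd p})"
    using J by (auto simp: image_iff)
  finally show ?thesis by (simp add: case_prod_unfold)
qed

text \<open>The intersection is a face, and a face of a polytope is the hull of some of the generating points.\<close>

lemma convex_hull_Int_supporting_hyperplane:
  fixes V :: "'a::euclidean_space set"
  assumes "finite V" and "\<And>v. v \<in> V \<Longrightarrow> n \<bullet> v \<le> \<beta>"
  shows "convex hull V \<inter> {x. n \<bullet> x = \<beta>} = convex hull {v \<in> V. n \<bullet> v = \<beta>}"
proof
  have "convex hull V \<subseteq> {x. n \<bullet> x \<le> \<beta>}"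
    using assms(2) by (intro hull_minimal) (auto simp: convex_halfspace_le)
  hence "(convex hull V \<inter> {x. n \<bullet> x = \<beta>}) face_of convex hull V"
    by (intro face_of_Int_supporting_hyperplane_le) auto
  then obtain W where W: "W \<subseteq> V" "convex hull V \<inter> {x. n \<bullet> x = \<beta>} = convex hull W"
    using face_of_convex_hull_subset finite_imp_compact[OF assms(1)] by metis
  hence "W \<subseteq> {v \<in> V. n \<bullet> v = \<beta>}"
    using hull_subset[of W convex] by blast
  thus "convex hull V \<inter> {x. n \<bullet> x = \<beta>} \<subseteq> convex hull {v \<in> V. n \<bullet> v = \<beta>}"
    using W hull_mono by metis
next
  have "convex hull {v \<in> V. n \<bullet> v = \<beta>} \<subseteq> {x. n \<bullet> x = \<beta>}"
    by (intro hull_minimal) (auto simp: convex_hyperplane)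
  moreover have "convex hull {v \<in> V. n \<bullet> v = \<beta>} \<subseteq> convex hull V"
    by (intro hull_mono) auto
  ultimately show "convex hull {v \<in> V. n \<bullet> v = \<beta>} \<subseteq> convex hull V \<inter> {x. n \<bullet> x = \<beta>}"
    by blast
qed

section \<open>Vertices and halfspaces of the hexahedron\<close>

lemma inner_vector_3: "vector [p, q, r] \<bullet> (v::real^3) = p * v$1 + q * v$2 + r * v$3"
  by (simp add: inner_vec_def sum_3)

lemma rect_vertex_nth [simp]:
  "rect_vertex l w z s t $ 1 = s * l / 2" "rect_vertex l w z s t $ 2 = t * w / 2"
  "rect_vertex l w z s t $ 3 = z"
  by (simp_all add: rect_vertex_def)

lemma rect_vertex_interpolate:
  "rect_vertex l w z \<alpha> \<gamma> =
     ((1 - \<alpha>) / 2) *\<^sub>R rect_vertex l w z (-1) \<gamma> + ((1 + \<alpha>) / 2) *\<^sub>R rect_vertex l w z 1 \<gamma>"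
  "rect_vertex l w z \<alpha> \<gamma> =
     ((1 - \<gamma>) / 2) *\<^sub>R rect_vertex l w z \<alpha> (-1) + ((1 + \<gamma>) / 2) *\<^sub>R rect_vertex l w z \<alpha> 1"
  by (simp_all add: vec_eq_iff forall_3 field_simps)

lemma rect_vertex_in_convex:
  assumes C: "convex C"
    and corner: "\<And>s t. s \<in> {-1, 1} \<Longrightarrow> t \<in> {-1, 1} \<Longrightarrow> rect_vertex l w z s t \<in> C"
    and "\<bar>\<alpha>\<bar> \<le> 1" and "\<bar>\<gamma>\<bar> \<le> 1"
  shows "rect_vertex l w z \<alpha> \<gamma> \<in> C"
proof -
  have "rect_vertex l w z \<alpha> t \<in> C" if "t \<in> {-1, 1}" for t
    unfolding rect_vertex_interpolate(1)[of l w z \<alpha>]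
    using assms that by (intro convexD[OF C]) (auto simp: field_simps)
  thus ?thesis
    unfolding rect_vertex_interpolate(2)[of l w z \<alpha> \<gamma>]
    using assms by (intro convexD[OF C]) (auto simp: field_simps)
qed

lemma rect_vertex_in_affine:
  assumes C: "affine C"
    and corner: "\<And>s t. s \<in> {-1, 1} \<Longrightarrow> t \<in> {-1, 1} \<Longrightarrow> rect_vertex l w z s t \<in> C"
  shows "rect_vertex l w z \<alpha> \<gamma> \<in> C"
proof -
  have "rect_vertex l w z \<alpha> t \<in> C" if "t \<in> {-1, 1}" for t
    unfolding rect_vertex_interpolate(1)[of l w z \<alpha>]
    using corner that by (intro mem_affine[OF C]) (auto simp: field_simps)
  thus ?thesis
    unfolding rect_vertex_interpolate(2)[of l w z \<alpha> \<gamma>]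
    by (intro mem_affine[OF C]) (auto simp: field_simps)
qed

definition hexahedron_vertices :: "real \<Rightarrow> real \<Rightarrow> real \<Rightarrow> (real^3) set" where
  "hexahedron_vertices a b h =
     {rect_vertex a b 0 s t | s t. s \<in> {-1, 1} \<and> t \<in> {-1, 1}} \<union>
     {rect_vertex b a h s t | s t. s \<in> {-1, 1} \<and> t \<in> {-1, 1}}"

lemma hexahedron_eq_hull: "hexahedron a b h = convex hull hexahedron_vertices a b h"
  by (simp add: hexahedron_def hexahedron_vertices_def)

lemma hexahedron_vertices_explicit:
  "hexahedron_vertices a b h =
    {rect_vertex a b 0 (-1) (-1), rect_vertex a b 0 1 (-1),
     rect_vertex a b 0 (-1) 1, rect_vertex a b 0 1 1,
     rect_vertex b a h (-1) (-1), rect_vertex b a h 1 (-1),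
     rect_vertex b a h (-1) 1, rect_vertex b a h 1 1}"
  unfolding hexahedron_vertices_def by auto

lemma finite_hexahedron_vertices: "finite (hexahedron_vertices a b h)"
  by (simp add: hexahedron_vertices_explicit)

lemma corner_in_hexahedron:
  assumes "s \<in> {-1, 1}" "t \<in> {-1, 1}"
  shows "rect_vertex a b 0 s t \<in> hexahedron a b h" "rect_vertex b a h s t \<in> hexahedron a b h"
  unfolding hexahedron_eq_hull using assms
  by (auto intro!: hull_inc simp: hexahedron_vertices_def)

text \<open>Rate at which the half-width in the first direction grows with the height; the half-width in the
  second direction shrinks at the same rate.\<close>

definition slope :: "real \<Rightarrow> real \<Rightarrow> real \<Rightarrow> real" where
  "slope a b h = (b - a) / (2 * h)"

lemma slope_mult_height: "h > 0 \<Longrightarrow> slope a b h * h = (b - a) / 2"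
  by (simp add: slope_def)

definition hexahedron_halfspaces :: "real \<Rightarrow> real \<Rightarrow> real \<Rightarrow> ((real^3) \<times> real) set" where
  "hexahedron_halfspaces a b h =
     {(vector [0, 0, -1], 0), (vector [0, 0, 1], h),
      (vector [-1, 0, - slope a b h], a / 2), (vector [1, 0, - slope a b h], a / 2),
      (vector [0, -1, slope a b h], b / 2), (vector [0, 1, slope a b h], b / 2)}"

lemma hexahedron_vertices_in_halfspaces:
  assumes "a > 0" "b > 0" "h > 0"
    and "v \<in> hexahedron_vertices a b h" and "(n, \<beta>) \<in> hexahedron_halfspaces a b h"
  shows "n \<bullet> v \<le> \<beta>"
  using assms slope_mult_height[OF assms(3), of a b]
  by (auto simp: hexahedron_vertices_explicit hexahedron_halfspaces_def inner_vector_3)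

text \<open>The horizontal section at height \<open>l * h\<close> is the rectangle whose sides interpolate linearly between
  those of the bottom and the top. A point of it with relative coordinates \<open>\<alpha>, \<gamma>\<close> in \<open>[-1, 1]\<close> lies on
  the segment that joins the points of the two base rectangles with the same relative coordinates.\<close>

lemma hexahedron_eq_halfspaces:
  assumes "a > 0" "b > 0" "h > 0"
  shows "hexahedron a b h = {v. \<forall>(n, \<beta>)\<in>hexahedron_halfspaces a b h. n \<bullet> v \<le> \<beta>}"
proof
  have "convex (\<Inter>(n, \<beta>)\<in>hexahedron_halfspaces a b h. {v. n \<bullet> v \<le> \<beta>})"
    by (intro convex_INT) (auto simp: convex_halfspace_le)
  also have "(\<Inter>(n, \<beta>)\<in>hexahedron_halfspaces a b h. {v. n \<bullet> v \<le> \<beta>}) =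
      {v. \<forall>(n, \<beta>)\<in>hexahedron_halfspaces a b h. n \<bullet> v \<le> \<beta>}" by auto
  finally show "hexahedron a b h \<subseteq> {v. \<forall>(n, \<beta>)\<in>hexahedron_halfspaces a b h. n \<bullet> v \<le> \<beta>}"
    unfolding hexahedron_eq_hull
    using hexahedron_vertices_in_halfspaces[OF assms] by (intro hull_minimal) auto
next
  show "{v. \<forall>(n, \<beta>)\<in>hexahedron_halfspaces a b h. n \<bullet> v \<le> \<beta>} \<subseteq> hexahedron a b h"
  proof
    fix v :: "real^3"
    assume "v \<in> {v. \<forall>(n, \<beta>)\<in>hexahedron_halfspaces a b h. n \<bullet> v \<le> \<beta>}"
    hence z: "0 \<le> v$3" "v$3 \<le> h" and x: "\<bar>v$1\<bar> \<le> a / 2 + slope a b h * v$3"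
      and y: "\<bar>v$2\<bar> \<le> b / 2 - slope a b h * v$3"
      by (auto simp: hexahedron_halfspaces_def inner_vector_3)
    define l where "l = v$3 / h"
    have l: "0 \<le> l" "l \<le> 1" "v$3 = l * h"
      using z assms by (simp_all add: l_def)
    define w w' where "w = (1 - l) * a / 2 + l * b / 2" and "w' = (1 - l) * b / 2 + l * a / 2"
    have pos: "0 < w" "0 < w'"
    proof -
      have "0 < p * a / 2 + q * b / 2" "0 < p * b / 2 + q * a / 2"
        if "0 \<le> p" "0 \<le> q" "p + q = 1" for p q
        using that assms by (cases "p = 0"; simp add: add_pos_nonneg)+
      thus "0 < w" "0 < w'" using l by (simp_all add: w_def w'_def)
    qed
    have "slope a b h * v$3 = l * ((b - a) / 2)"
      using slope_mult_height[OF assms(3), of a b] l(3) by (metis mult.left_commute)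
    hence xy: "\<bar>v$1\<bar> \<le> w" "\<bar>v$2\<bar> \<le> w'"
      using x y by (simp_all add: w_def w'_def field_simps)
    have conv: "convex (hexahedron a b h)" by (simp add: hexahedron_eq_hull)
    define \<alpha> \<gamma> where "\<alpha> = v$1 / w" and "\<gamma> = v$2 / w'"
    have \<alpha>\<gamma>: "\<bar>\<alpha>\<bar> \<le> 1" "\<bar>\<gamma>\<bar> \<le> 1" "v$1 = \<alpha> * w" "v$2 = \<gamma> * w'"
      using xy pos by (simp_all add: \<alpha>_def \<gamma>_def)
    have "(1 - l) *\<^sub>R rect_vertex a b 0 \<alpha> \<gamma> + l *\<^sub>R rect_vertex b a h \<alpha> \<gamma> \<in> hexahedron a b h"
      using l \<alpha>\<gamma> rect_vertex_in_convex[OF conv] corner_in_hexahedron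
      by (intro convexD[OF conv]) simp_all
    also have "(1 - l) *\<^sub>R rect_vertex a b 0 \<alpha> \<gamma> + l *\<^sub>R rect_vertex b a h \<alpha> \<gamma> = v"
      unfolding vec_eq_iff forall_3 \<alpha>\<gamma> l(3) w_def w'_def by (simp add: field_simps)
    finally show "v \<in> hexahedron a b h" .
  qed
qed

lemma affine_hull_hexahedron:
  assumes "a > 0" "b > 0" "h > 0"
  shows "affine hull (hexahedron a b h) = UNIV"
proof -
  let ?U = "\<Inter>(n, \<beta>)\<in>hexahedron_halfspaces a b h. {v. n \<bullet> v < \<beta>}"
  have "open ?U"
    by (intro open_INT ballI)
      (simp_all add: hexahedron_halfspaces_def case_prod_unfold open_halfspace_lt)
  moreover have "?U \<subseteq> hexahedron a b h"
    unfolding hexahedron_eq_halfspaces[OF assms] by fastforce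
  moreover have "vector [0, 0, h / 2] \<in> ?U"
    using assms slope_mult_height[OF assms(3), of a b]
    by (auto simp: hexahedron_halfspaces_def inner_vector_3 field_simps)
  ultimately have "interior (hexahedron a b h) \<noteq> {}"
    using interior_maximal by blast
  thus ?thesis by (rule affine_hull_nonempty_interior)
qed

lemma hexahedron_halfspaces_irredundant:
  assumes pos: "a > 0" "b > 0" "h > 0" and mem: "(n, \<beta>) \<in> hexahedron_halfspaces a b h"
  shows "\<exists>x. \<beta> < n \<bullet> x \<and> (\<forall>(n', \<beta>')\<in>hexahedron_halfspaces a b h - {(n, \<beta>)}. n' \<bullet> x \<le> \<beta>')"
proof -
  define k where "k = slope a b h"
  have kh: "k * h = (b - a) / 2" using slope_mult_height[OF pos(3)] by (simp add: k_def)
  \<comment> \<open>Going \<open>\<epsilon>\<close> above the top or below the bottom changes the half-widths by so little that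
    the axis stays between the four planes of the trapezoids.\<close>
  define \<epsilon> where "\<epsilon> = min a b / (2 * (\<bar>k\<bar> + 1))"
  have \<epsilon>: "\<epsilon> > 0" using pos by (simp add: \<epsilon>_def add_nonneg_pos)
  have "\<bar>k * \<epsilon>\<bar> \<le> (\<bar>k\<bar> + 1) * \<epsilon>" using \<epsilon> by (simp add: abs_mult)
  also have "\<dots> = min a b / 2" by (simp add: \<epsilon>_def field_simps)
  finally have k\<epsilon>: "\<bar>k * \<epsilon>\<bar> \<le> a / 2" "\<bar>k * \<epsilon>\<bar> \<le> b / 2" by auto
  define P where "P = (\<lambda>x. \<beta> < n \<bullet> x \<and>
     (\<forall>(n', \<beta>')\<in>hexahedron_halfspaces a b h - {(n, \<beta>)}. n' \<bullet> x \<le> \<beta>'))"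
  have "P (vector [0, 0, - \<epsilon>]) \<or> P (vector [0, 0, h + \<epsilon>]) \<or>
      P (vector [- (a + b), 0, h / 2]) \<or> P (vector [a + b, 0, h / 2]) \<or>
      P (vector [0, - (a + b), h / 2]) \<or> P (vector [0, a + b, h / 2])"
    using mem unfolding hexahedron_halfspaces_def k_def[symmetric]
  proof (elim insertE)
    assume "(n, \<beta>) = (vector [0, 0, -1], 0)"
    hence "P (vector [0, 0, - \<epsilon>])"
      using pos kh \<epsilon> k\<epsilon>
      by (auto simp: P_def hexahedron_halfspaces_def inner_vector_3 algebra_simps simp flip: k_def)
    thus ?thesis by blast
  next
    assume "(n, \<beta>) = (vector [0, 0, 1], h)"
    hence "P (vector [0, 0, h + \<epsilon>])"
      using pos kh \<epsilon> k\<epsilon>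
      by (auto simp: P_def hexahedron_halfspaces_def inner_vector_3 algebra_simps simp flip: k_def)
    thus ?thesis by blast
  next
    assume "(n, \<beta>) = (vector [- 1, 0, - k], a / 2)"
    hence "P (vector [- (a + b), 0, h / 2])"
      using pos kh
      by (auto simp: P_def hexahedron_halfspaces_def inner_vector_3 algebra_simps simp flip: k_def)
    thus ?thesis by blast
  next
    assume "(n, \<beta>) = (vector [1, 0, - k], a / 2)"
    hence "P (vector [a + b, 0, h / 2])"
      using pos kh
      by (auto simp: P_def hexahedron_halfspaces_def inner_vector_3 algebra_simps simp flip: k_def)
    thus ?thesis by blast
  next
    assume "(n, \<beta>) = (vector [0, - 1, k], b / 2)"
    hence "P (vector [0, - (a + b), h / 2])"
      using pos kh
      by (auto simp: P_def hexahedron_halfspaces_def inner_vector_3 algebra_simps simp flip: k_def)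
    thus ?thesis by blast
  next
    assume "(n, \<beta>) = (vector [0, 1, k], b / 2)"
    hence "P (vector [0, a + b, h / 2])"
      using pos kh
      by (auto simp: P_def hexahedron_halfspaces_def inner_vector_3 algebra_simps simp flip: k_def)
    thus ?thesis by blast
  qed simp
  thus ?thesis unfolding P_def by blast
qed

section \<open>Faces and extreme points of the hexahedron\<close>

definition rect_face :: "real \<Rightarrow> real \<Rightarrow> real \<Rightarrow> (real^3) set" where
  "rect_face l w z = convex hull
     {rect_vertex l w z (-1) (-1), rect_vertex l w z 1 (-1),
      rect_vertex l w z (-1) 1, rect_vertex l w z 1 1}"

definition side_x :: "real \<Rightarrow> real \<Rightarrow> real \<Rightarrow> real \<Rightarrow> (real^3) set" where
  "side_x a b h s = convex hull
     {rect_vertex a b 0 s (-1), rect_vertex a b 0 s 1,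
      rect_vertex b a h s (-1), rect_vertex b a h s 1}"

definition side_y :: "real \<Rightarrow> real \<Rightarrow> real \<Rightarrow> real \<Rightarrow> (real^3) set" where
  "side_y a b h t = convex hull
     {rect_vertex a b 0 (-1) t, rect_vertex a b 0 1 t,
      rect_vertex b a h (-1) t, rect_vertex b a h 1 t}"

lemma hexahedron_Int_boundary_planes:
  assumes pos: "a > 0" "b > 0" "h > 0"
  shows "hexahedron a b h \<inter> {x. vector [0, 0, -1] \<bullet> x = 0} = rect_face a b 0"
    and "hexahedron a b h \<inter> {x. vector [0, 0, 1] \<bullet> x = h} = rect_face b a h"
    and "s \<in> {-1, 1} \<Longrightarrow>
      hexahedron a b h \<inter> {x. vector [s, 0, - slope a b h] \<bullet> x = a / 2} = side_x a b h s"
    and "t \<in> {-1, 1} \<Longrightarrow>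
      hexahedron a b h \<inter> {x. vector [0, t, slope a b h] \<bullet> x = b / 2} = side_y a b h t"
proof -
  have *: "hexahedron a b h \<inter> {x. n \<bullet> x = \<beta>} = convex hull W"
    if "(n, \<beta>) \<in> hexahedron_halfspaces a b h" "{v \<in> hexahedron_vertices a b h. n \<bullet> v = \<beta>} = W"
    for n \<beta> W
    unfolding hexahedron_eq_hull that(2)[symmetric]
    using that(1) hexahedron_vertices_in_halfspaces[OF pos] finite_hexahedron_vertices
    by (intro convex_hull_Int_supporting_hyperplane) auto
  have kh: "slope a b h * h = (b - a) / 2" using slope_mult_height[OF pos(3)] .
  show "hexahedron a b h \<inter> {x. vector [0, 0, -1] \<bullet> x = 0} = rect_face a b 0"
    unfolding rect_face_def using pos
    by (intro *) (auto simp: hexahedron_halfspaces_def hexahedron_vertices_explicit inner_vector_3)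
  show "hexahedron a b h \<inter> {x. vector [0, 0, 1] \<bullet> x = h} = rect_face b a h"
    unfolding rect_face_def using pos
    by (intro *) (auto simp: hexahedron_halfspaces_def hexahedron_vertices_explicit inner_vector_3)
  show "hexahedron a b h \<inter> {x. vector [s, 0, - slope a b h] \<bullet> x = a / 2} = side_x a b h s"
    if "s \<in> {-1, 1}"
    unfolding side_x_def using pos kh that
    by (intro *) (auto simp: hexahedron_halfspaces_def hexahedron_vertices_explicit inner_vector_3)
  show "hexahedron a b h \<inter> {x. vector [0, t, slope a b h] \<bullet> x = b / 2} = side_y a b h t"
    if "t \<in> {-1, 1}"
    unfolding side_y_def using pos kh that
    by (intro *) (auto simp: hexahedron_halfspaces_def hexahedron_vertices_explicit inner_vector_3)
qed

lemma facets_of_hexahedron: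
  assumes pos: "a > 0" "b > 0" "h > 0"
  shows "{F. F facet_of hexahedron a b h} =
     {rect_face a b 0, rect_face b a h} \<union>
     {side_x a b h (-1), side_x a b h 1, side_y a b h (-1), side_y a b h 1}"
proof -
  have "F facet_of hexahedron a b h \<longleftrightarrow>
      (\<exists>(n, \<beta>)\<in>hexahedron_halfspaces a b h. F = hexahedron a b h \<inter> {x. n \<bullet> x = \<beta>})" for F
    using affine_hull_hexahedron[OF pos] hexahedron_halfspaces_irredundant[OF pos]
      hexahedron_eq_halfspaces[OF pos]
    by (intro facet_of_irredundant_halfspaces) (auto simp: hexahedron_halfspaces_def)
  thus ?thesis
    unfolding hexahedron_halfspaces_def
    using hexahedron_Int_boundary_planes[OF pos] by auto
qed

text \<open>At each vertex the sum of the outer normals of the three faces through it has its maximum over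
  the solid at that vertex only. In this sum the slopes cancel.\<close>

lemma extreme_points_of_hexahedron:
  assumes pos: "a > 0" "b > 0" "h > 0"
  shows "{v. v extreme_point_of hexahedron a b h} = hexahedron_vertices a b h"
proof
  show "{v. v extreme_point_of hexahedron a b h} \<subseteq> hexahedron_vertices a b h"
    unfolding hexahedron_eq_hull by (auto dest: extreme_point_of_convex_hull)
next
  have *: "w extreme_point_of hexahedron a b h"
    if "\<And>v. v \<in> hexahedron_vertices a b h \<Longrightarrow> n \<bullet> v \<le> \<beta>"
      and "{v \<in> hexahedron_vertices a b h. n \<bullet> v = \<beta>} = {w}" for n \<beta> w
  proof -
    have "hexahedron a b h \<inter> {v. n \<bullet> v = \<beta>} = {w}"
      using convex_hull_Int_supporting_hyperplane[OF finite_hexahedron_vertices that(1)]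
      by (simp add: hexahedron_eq_hull that(2))
    moreover have "hexahedron a b h \<subseteq> {v. n \<bullet> v \<le> \<beta>}"
      unfolding hexahedron_eq_hull
      using that(1) by (intro hull_minimal) (auto simp: convex_halfspace_le)
    ultimately show ?thesis
      by (intro extreme_point_of_Int_supporting_hyperplane_le) auto
  qed
  have "rect_vertex a b 0 s t extreme_point_of hexahedron a b h"
    if "s \<in> {-1, 1}" "t \<in> {-1, 1}" for s t
  proof (rule *)
    show "vector [s, t, -1] \<bullet> v \<le> a / 2 + b / 2" if "v \<in> hexahedron_vertices a b h" for v
      using pos \<open>s \<in> _\<close> \<open>t \<in> _\<close> that
      by (auto simp: hexahedron_vertices_explicit inner_vector_3)
    show "{v \<in> hexahedron_vertices a b h. vector [s, t, -1] \<bullet> v = a / 2 + b / 2} =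
        {rect_vertex a b 0 s t}"
    proof (intro equalityI subsetI)
      fix v assume "v \<in> {v \<in> hexahedron_vertices a b h. vector [s, t, -1] \<bullet> v = a / 2 + b / 2}"
      hence "v \<in> hexahedron_vertices a b h" "s * v$1 + t * v$2 - v$3 = a / 2 + b / 2"
        by (auto simp: inner_vector_3)
      thus "v \<in> {rect_vertex a b 0 s t}"
        using pos that unfolding hexahedron_vertices_explicit
        by (elim insertE emptyE; simp; fail)
    qed (use that in \<open>auto simp: hexahedron_vertices_def inner_vector_3\<close>)
  qed
  moreover have "rect_vertex b a h s t extreme_point_of hexahedron a b h"
    if "s \<in> {-1, 1}" "t \<in> {-1, 1}" for s t
  proof (rule *)
    show "vector [s, t, 1] \<bullet> v \<le> a / 2 + b / 2 + h" if "v \<in> hexahedron_vertices a b h" for v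
      using pos \<open>s \<in> _\<close> \<open>t \<in> _\<close> that
      by (auto simp: hexahedron_vertices_explicit inner_vector_3)
    show "{v \<in> hexahedron_vertices a b h. vector [s, t, 1] \<bullet> v = a / 2 + b / 2 + h} =
        {rect_vertex b a h s t}"
    proof (intro equalityI subsetI)
      fix v assume "v \<in> {v \<in> hexahedron_vertices a b h. vector [s, t, 1] \<bullet> v = a / 2 + b / 2 + h}"
      hence "v \<in> hexahedron_vertices a b h" "s * v$1 + t * v$2 + v$3 = a / 2 + b / 2 + h"
        by (auto simp: inner_vector_3)
      thus "v \<in> {rect_vertex b a h s t}"
        using pos that unfolding hexahedron_vertices_explicit
        by (elim insertE emptyE; simp; fail)
    qed (use that in \<open>auto simp: hexahedron_vertices_def inner_vector_3\<close>)
  qed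
  ultimately show "hexahedron_vertices a b h \<subseteq> {v. v extreme_point_of hexahedron a b h}"
    by (auto simp: hexahedron_vertices_def)
qed

lemma rectangle_rect_face:
  assumes "l > 0" "w > 0"
  shows "rectangle (rect_face l w z)"
proof -
  define p u v :: "real^3" where
    "p = rect_vertex l w z (-1) (-1)" and "u = vector [l, 0, 0]" and "v = vector [0, w, 0]"
  have "{rect_vertex l w z (-1) (-1), rect_vertex l w z 1 (-1),
      rect_vertex l w z (-1) 1, rect_vertex l w z 1 1} = {p, p + u, p + v, p + u + v}"
  proof -
    have "rect_vertex l w z 1 (-1) = p + u" "rect_vertex l w z (-1) 1 = p + v"
      "rect_vertex l w z 1 1 = p + u + v"
      by (simp_all add: p_def u_def v_def vec_eq_iff forall_3)
    thus ?thesis by (simp add: p_def)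
  qed
  moreover have "u \<noteq> 0" "v \<noteq> 0" "orthogonal u v"
    using assms by (simp_all add: u_def v_def vec_eq_iff forall_3 orthogonal_def inner_vector_3)
  ultimately show ?thesis unfolding rectangle_def rect_face_def by metis
qed

lemma not_collinear_horizontal_step:
  fixes p q u :: "real^3"
  assumes "u \<noteq> 0" and "u$3 = 0" and "q$3 \<noteq> p$3"
  shows "\<not> collinear {p, p + u, q}"
proof
  assume "collinear {p, p + u, q}"
  hence "collinear {p + u, p, q}" by (simp add: insert_commute)
  hence "collinear {0, u, q - p}" by (subst (asm) collinear_3) simp_all
  thus False using assms by (auto simp: collinear_lemma vec_eq_iff forall_3)
qed

lemma trapezoid_side_x:
  assumes pos: "a > 0" "b > 0" "h > 0" and "a \<noteq> b"
  shows "trapezoid (side_x a b h s)"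
proof -
  define p q u :: "real^3" where
    "p = rect_vertex a b 0 s (-1)" and "q = rect_vertex b a h s (-1)" and "u = vector [0, b, 0]"
  have "rect_vertex a b 0 s 1 = p + u" "rect_vertex b a h s 1 = q + (a / b) *\<^sub>R u"
    using pos by (simp_all add: p_def q_def u_def vec_eq_iff forall_3)
  hence "side_x a b h s = convex hull {p, p + u, q, q + (a / b) *\<^sub>R u}"
    by (simp add: side_x_def p_def q_def)
  moreover have "\<not> collinear {p, p + u, q}"
    using pos by (intro not_collinear_horizontal_step)
      (simp_all add: p_def q_def u_def vec_eq_iff forall_3)
  moreover have "a / b > 0" "a / b \<noteq> 1" using assms by auto
  ultimately show ?thesis unfolding trapezoid_def by metis
qed

lemma trapezoid_side_y:
  assumes pos: "a > 0" "b > 0" "h > 0" and "a \<noteq> b"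
  shows "trapezoid (side_y a b h t)"
proof -
  define p q u :: "real^3" where
    "p = rect_vertex a b 0 (-1) t" and "q = rect_vertex b a h (-1) t" and "u = vector [a, 0, 0]"
  have "rect_vertex a b 0 1 t = p + u" "rect_vertex b a h 1 t = q + (b / a) *\<^sub>R u"
    using pos by (simp_all add: p_def q_def u_def vec_eq_iff forall_3)
  hence "side_y a b h t = convex hull {p, p + u, q, q + (b / a) *\<^sub>R u}"
    by (simp add: side_y_def p_def q_def)
  moreover have "\<not> collinear {p, p + u, q}"
    using pos by (intro not_collinear_horizontal_step)
      (simp_all add: p_def q_def u_def vec_eq_iff forall_3)
  moreover have "b / a > 0" "b / a \<noteq> 1" using assms by auto
  ultimately show ?thesis unfolding trapezoid_def by metis
qed

lemma affine_hull_rect_face: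
  assumes "l > 0" "w > 0"
  shows "affine hull (rect_face l w z) = {v. v$3 = z}"
proof
  have "affine {v::real^3. v$3 = z}"
    using affine_hyperplane[of "vector [0, 0, 1] :: real^3" z] by (simp add: inner_vector_3)
  thus "affine hull (rect_face l w z) \<subseteq> {v. v$3 = z}"
    unfolding rect_face_def affine_hull_convex_hull by (intro hull_minimal) auto
next
  show "{v. v$3 = z} \<subseteq> affine hull (rect_face l w z)"
  proof
    fix v :: "real^3" assume "v \<in> {v. v$3 = z}"
    hence "v = rect_vertex l w z (2 * v$1 / l) (2 * v$2 / w)"
      using assms by (simp add: vec_eq_iff forall_3)
    also have "\<dots> \<in> affine hull (rect_face l w z)"
      unfolding rect_face_def affine_hull_convex_hull
      by (rule rect_vertex_in_affine) (auto intro!: hull_inc)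
    finally show "v \<in> affine hull (rect_face l w z)" .
  qed
qed

section \<open>Congruent faces\<close>

lemma congruent_sets_trans:
  assumes "congruent_sets P Q" and "congruent_sets Q R"
  shows "congruent_sets P R"
proof -
  obtain g k where "similarity_map 1 g" "g ` P = Q" "similarity_map 1 k" "k ` Q = R"
    using assms by (auto simp: congruent_sets_def)
  hence "similarity_map 1 (k \<circ> g)" "(k \<circ> g) ` P = R"
    by (auto simp: similarity_map_def)
  thus ?thesis by (auto simp: congruent_sets_def)
qed

lemma congruent_sets_convex_hull:
  assumes "orthogonal_transformation g"
  shows "congruent_sets (convex hull S) (convex hull ((\<lambda>x. c + g x) ` S))"
proof -
  have lin: "linear g" using assms by (simp add: orthogonal_transformation)
  have "similarity_map 1 (\<lambda>x. c + g x)"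
    using assms by (simp add: similarity_map_def dist_norm orthogonal_transformation
        flip: linear_diff)
  moreover have "(\<lambda>x. c + g x) ` (convex hull S) = convex hull ((\<lambda>x. c + g x) ` S)"
    using convex_hull_translation[of c "g ` S"] convex_hull_linear_image[OF lin, of S]
    by (metis image_image)
  ultimately show ?thesis by (auto simp: congruent_sets_def)
qed

text \<open>Together with the next lemma: the symmetries of the solid. Reflections in the two vertical
  coordinate planes exchange opposite trapezoids; exchanging the first two coordinates while turning
  the solid upside down maps each trapezoid to an adjacent one and one rectangle to the other.\<close>

lemma congruent_sets_mirror:
  assumes "s \<in> {-1, 1}" "t \<in> {-1, 1}"
  shows "congruent_sets (convex hull S)
     (convex hull ((\<lambda>v. vector [s * v$1, t * v$2, v$3]) ` S))"
proof -
  have "orthogonal_transformation (\<lambda>v::real^3. vector [s * v$1, t * v$2, v$3] :: real^3)"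
    unfolding orthogonal_transformation
    using assms by (auto intro!: linearI
        simp: vec_eq_iff forall_3 norm_eq_sqrt_inner inner_vec_def sum_3 algebra_simps)
  from congruent_sets_convex_hull[OF this, of S 0] show ?thesis by simp
qed

lemma congruent_sets_swap:
  "congruent_sets (convex hull S) (convex hull ((\<lambda>v. vector [v$2, v$1, h - v$3]) ` S))"
proof -
  have "orthogonal_transformation (\<lambda>v::real^3. vector [v$2, v$1, - v$3] :: real^3)"
    unfolding orthogonal_transformation
    by (auto intro!: linearI
        simp: vec_eq_iff forall_3 norm_eq_sqrt_inner inner_vec_def sum_3 algebra_simps)
  from congruent_sets_convex_hull[OF this, of S "vector [0, 0, h]"]
  have "congruent_sets (convex hull S)
      (convex hull ((\<lambda>v. vector [0, 0, h] + vector [v$2, v$1, - v$3]) ` S))" .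
  also have "(\<lambda>v. vector [0, 0, h] + vector [v$2, v$1, - v$3]) =
      (\<lambda>v::real^3. vector [v$2, v$1, h - v$3] :: real^3)"
    by (simp add: fun_eq_iff vec_eq_iff forall_3)
  finally show ?thesis .
qed

lemma mirror_rect_vertex:
  "vector [s' * rect_vertex l w z s t $ 1, t' * rect_vertex l w z s t $ 2, rect_vertex l w z s t $ 3] =
     rect_vertex l w z (s' * s) (t' * t)"
  by (simp add: vec_eq_iff forall_3)

lemma swap_rect_vertex:
  "vector [rect_vertex l w z s t $ 2, rect_vertex l w z s t $ 1, h - rect_vertex l w z s t $ 3] =
     rect_vertex w l (h - z) t s"
  by (simp add: vec_eq_iff forall_3)

lemma congruent_rect_faces: "congruent_sets (rect_face a b 0) (rect_face b a h)"
proof -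
  let ?V = "\<lambda>l w z. {rect_vertex l w z (-1) (-1), rect_vertex l w z 1 (-1),
      rect_vertex l w z (-1) 1, rect_vertex l w z 1 1}"
  have "(\<lambda>v. vector [v$2, v$1, h - v$3]) ` ?V a b 0 = ?V b a h"
    unfolding image_insert image_empty swap_rect_vertex diff_zero by blast
  with congruent_sets_swap[of "?V a b 0" h] show ?thesis unfolding rect_face_def by argo
qed

lemma congruent_sides:
  assumes "S \<in> {side_x a b h (-1), side_x a b h 1, side_y a b h (-1), side_y a b h 1}"
    and "T \<in> {side_x a b h (-1), side_x a b h 1, side_y a b h (-1), side_y a b h 1}"
  shows "congruent_sets S T"
proof -
  let ?X = "\<lambda>s. {rect_vertex a b 0 s (-1), rect_vertex a b 0 s 1,
      rect_vertex b a h s (-1), rect_vertex b a h s 1}"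
  let ?Y = "\<lambda>t. {rect_vertex a b 0 (-1) t, rect_vertex a b 0 1 t,
      rect_vertex b a h (-1) t, rect_vertex b a h 1 t}"
  let ?swap = "\<lambda>v. vector [v$2, v$1, h - v$3]"
  have xx: "congruent_sets (side_x a b h s) (side_x a b h t)" if "s \<in> {-1, 1}" "t \<in> {-1, 1}" for s t
  proof -
    have st: "s * t * s = t" "s * t \<in> {-1, 1}" using that by auto
    have "(\<lambda>v. vector [s * t * v$1, 1 * v$2, v$3]) ` ?X s = ?X t"
      unfolding image_insert image_empty mirror_rect_vertex unfolding st mult_1_left ..
    with congruent_sets_mirror[of "s * t" 1 "?X s"] st show ?thesis
      unfolding side_x_def by simp
  qed
  have xy: "congruent_sets (side_x a b h s) (side_y a b h s)" for s
  proof -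
    have "?swap ` ?X s = ?Y s"
      unfolding image_insert image_empty swap_rect_vertex diff_zero diff_self by blast
    with congruent_sets_swap[of "?X s" h] show ?thesis unfolding side_x_def side_y_def by argo
  qed
  have yx: "congruent_sets (side_y a b h s) (side_x a b h s)" for s
  proof -
    have "?swap ` ?Y s = ?X s"
      unfolding image_insert image_empty swap_rect_vertex diff_zero diff_self by blast
    with congruent_sets_swap[of "?Y s" h] show ?thesis unfolding side_x_def side_y_def by argo
  qed
  obtain s where s: "s \<in> {-1, 1}" "S = side_x a b h s \<or> S = side_y a b h s" using assms(1) by blast
  obtain t where t: "t \<in> {-1, 1}" "T = side_x a b h t \<or> T = side_y a b h t" using assms(2) by blast
  show ?thesis using xx xy yx s t congruent_sets_trans by metis
qed

lemma two_rectangles_four_trapezoids_hexahedron: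
  assumes pos: "a > 0" "b > 0" "h > 0" and "a \<noteq> b"
  shows "two_rectangles_four_trapezoids (hexahedron a b h)"
proof -
  let ?R1 = "rect_face a b 0" and ?R2 = "rect_face b a h"
  let ?\<T> = "{side_x a b h (-1), side_x a b h 1, side_y a b h (-1), side_y a b h 1}"
  \<comment> \<open>The vertices of the bottom suffice to tell the four trapezoids apart.\<close>
  have x: "rect_vertex a b 0 s t \<in> side_x a b h s' \<longleftrightarrow> s = s'"
    if "s \<in> {-1, 1}" "t \<in> {-1, 1}" "s' \<in> {-1, 1}" for s t s'
    using that corner_in_hexahedron(1) pos
    by (auto simp: inner_vector_3 simp flip: hexahedron_Int_boundary_planes(3)[OF pos])
  have y: "rect_vertex a b 0 s t \<in> side_y a b h t' \<longleftrightarrow> t = t'"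
    if "s \<in> {-1, 1}" "t \<in> {-1, 1}" "t' \<in> {-1, 1}" for s t t'
    using that corner_in_hexahedron(1) pos
    by (auto simp: inner_vector_3 simp flip: hexahedron_Int_boundary_planes(4)[OF pos])
  have "polytope (hexahedron a b h)"
    unfolding polytope_def hexahedron_eq_hull using finite_hexahedron_vertices by blast
  moreover have "aff_dim (hexahedron a b h) = 3"
    using affine_hull_hexahedron[OF pos] aff_dim_eq_full[of "hexahedron a b h"] by simp
  moreover have "?R1 \<inter> ?R2 = {}"
  proof -
    have "?R1 \<subseteq> {v. v$3 = 0}" "?R2 \<subseteq> {v. v$3 = h}"
      using affine_hull_rect_face pos hull_subset by metis+
    thus ?thesis using pos by fastforce
  qed
  moreover have "affine_parallel (affine hull ?R1) (affine hull ?R2)"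
    unfolding affine_parallel_def
  proof
    have "v \<in> (\<lambda>x. vector [0, 0, h] + x) ` {v. v$3 = 0}" if "v$3 = h" for v :: "real^3"
      using that by (intro image_eqI[of _ _ "v - vector [0, 0, h]"]) auto
    thus "affine hull ?R2 = (\<lambda>x. vector [0, 0, h] + x) ` (affine hull ?R1)"
      using pos by (auto simp: affine_hull_rect_face)
  qed
  moreover have "card ?\<T> = 4"
  proof -
    have "side_x a b h (-1) \<noteq> side_x a b h 1" using x[of 1 1 1] x[of 1 1 "-1"] by auto
    moreover have "side_y a b h (-1) \<noteq> side_y a b h 1" using y[of 1 1 1] y[of 1 1 "-1"] by auto
    moreover have "side_x a b h s \<noteq> side_y a b h t" if "s \<in> {-1, 1}" "t \<in> {-1, 1}" for s t
      using x[of s "-t" s] y[of s "-t" t] that by auto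
    ultimately show ?thesis by simp
  qed
  moreover have "\<forall>T\<in>?\<T>. trapezoid T"
    using trapezoid_side_x[OF assms] trapezoid_side_y[OF assms] by blast
  moreover have "\<forall>S\<in>?\<T>. \<forall>T\<in>?\<T>. congruent_sets S T"
    using congruent_sides by blast
  ultimately show ?thesis
    unfolding two_rectangles_four_trapezoids_def
    using facets_of_hexahedron[OF pos] rectangle_rect_face pos congruent_rect_faces
    by metis
qed

section \<open>Distances between vertices\<close>

lemma dist_rect_vertex:
  "dist (rect_vertex l w z s t) (rect_vertex l' w' z' s' t') =
     sqrt (((s * l - s' * l') / 2)\<^sup>2 + ((t * w - t' * w') / 2)\<^sup>2 + (z - z')\<^sup>2)"
  by (simp add: rect_vertex_def dist_norm norm_eq_sqrt_inner inner_vec_def sum_3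
      power2_eq_square diff_divide_distrib)

text \<open>With \<open>a\<^sup>2 + b\<^sup>2 = c\<^sup>2\<close>, the hypothesis on \<open>h\<close> is the height equation of the solid.\<close>

lemma distances_between_hexahedron_vertices:
  fixes a b c d e f h :: real
  assumes nonneg: "0 \<le> a" "0 \<le> b" "0 \<le> c" "0 \<le> d" "0 \<le> e" "0 \<le> f"
    and c: "a\<^sup>2 + b\<^sup>2 = c\<^sup>2" and d: "d\<^sup>2 = e\<^sup>2 + a * b" and f: "f\<^sup>2 = d\<^sup>2 + a * b"
    and h: "c\<^sup>2 + 2 * h\<^sup>2 = 2 * d\<^sup>2"
    and st: "s \<in> {-1, 1}" "t \<in> {-1, 1}"
  defines "B \<equiv> rect_vertex a b 0" and "T \<equiv> rect_vertex b a h"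
  shows "dist (B s t) (B (-s) t) = a" "dist (B s t) (B s (-t)) = b"
    "dist (T s t) (T (-s) t) = b" "dist (T s t) (T s (-t)) = a"
    "dist (B s t) (B (-s) (-t)) = c" "dist (T s t) (T (-s) (-t)) = c"
    "dist (B s t) (T s t) = e"
    "dist (B s t) (T (-s) t) = d" "dist (B s t) (T s (-t)) = d"
    "dist (B s t) (T (-s) (-t)) = f"
proof -
  have signs: "((s * x - s * y) / 2)\<^sup>2 = (x - y)\<^sup>2 / 4" "((t * x - t * y) / 2)\<^sup>2 = (x - y)\<^sup>2 / 4"
    "((s * x - - s * y) / 2)\<^sup>2 = (x + y)\<^sup>2 / 4" "((t * x - - t * y) / 2)\<^sup>2 = (x + y)\<^sup>2 / 4"
    for x y
    using st by (auto simp: power2_eq_square field_simps)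
  note dist = dist_rect_vertex signs
  show "dist (B s t) (B (-s) t) = a" "dist (B s t) (B s (-t)) = b"
    "dist (T s t) (T (-s) t) = b" "dist (T s t) (T s (-t)) = a"
    "dist (B s t) (B (-s) (-t)) = c" "dist (T s t) (T (-s) (-t)) = c"
    "dist (B s t) (T s t) = e"
    "dist (B s t) (T (-s) t) = d" "dist (B s t) (T s (-t)) = d"
    "dist (B s t) (T (-s) (-t)) = f"
    unfolding B_def T_def dist
    by - (rule real_sqrt_unique; use nonneg c d f h in \<open>simp add: power2_eq_square field_simps\<close>)+
qed

lemma vertex_distance_cases:
  fixes a b c d e f h :: real
  assumes "0 \<le> a" "0 \<le> b" "0 \<le> c" "0 \<le> d" "0 \<le> e" "0 \<le> f"
    and "a\<^sup>2 + b\<^sup>2 = c\<^sup>2" and "d\<^sup>2 = e\<^sup>2 + a * b" and "f\<^sup>2 = d\<^sup>2 + a * b"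
    and "c\<^sup>2 + 2 * h\<^sup>2 = 2 * d\<^sup>2"
    and u: "u \<in> hexahedron_vertices a b h" and v: "v \<in> hexahedron_vertices a b h" and "u \<noteq> v"
  shows "dist u v \<in> {a, b, c, d, e, f}"
proof -
  note dists = distances_between_hexahedron_vertices[OF assms(1-10)]
  obtain s t where st: "s \<in> {-1, 1}" "t \<in> {-1, 1}"
    and u': "u = rect_vertex a b 0 s t \<or> u = rect_vertex b a h s t"
    using u unfolding hexahedron_vertices_def by blast
  obtain s' t' where st'': "s' \<in> {-1, 1}" "t' \<in> {-1, 1}"
    and v': "v = rect_vertex a b 0 s' t' \<or> v = rect_vertex b a h s' t'"
    using v unfolding hexahedron_vertices_def by blast
  \<comment> \<open>Signs of the second vertex relative to those of the first.\<close>
  from st st'' have st': "s' \<in> {s, -s}" "t' \<in> {t, -t}" by auto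
  have same: "dist u v \<in> {a, b, c, d, e, f}"
    if "u = rect_vertex l w z s t" "v = rect_vertex l w z s' t'" "(l, w, z) \<in> {(a, b, 0), (b, a, h)}"
    for l w z
    using st' that \<open>u \<noteq> v\<close> dists(1-6)[OF st] by (elim insertE emptyE) simp_all
  have mixed: "dist (rect_vertex a b 0 s t) (rect_vertex b a h s' t') \<in> {a, b, c, d, e, f}"
    if "s \<in> {-1, 1}" "t \<in> {-1, 1}" "s' \<in> {s, -s}" "t' \<in> {t, -t}" for s t s' t'
    using that(3,4) dists(7-10)[OF that(1,2)] by (elim insertE emptyE) simp_all
  have sym: "s \<in> {s', -s'}" "t \<in> {t', -t'}" using st' by auto
  from u' v' show ?thesis
  proof (elim disjE)
    assume "u = rect_vertex a b 0 s t" "v = rect_vertex a b 0 s' t'"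
    thus ?thesis by (rule same) simp
  next
    assume "u = rect_vertex b a h s t" "v = rect_vertex b a h s' t'"
    thus ?thesis by (rule same) simp
  next
    assume "u = rect_vertex a b 0 s t" "v = rect_vertex b a h s' t'"
    thus ?thesis using mixed[OF st st'] by simp
  next
    assume "u = rect_vertex b a h s t" "v = rect_vertex a b 0 s' t'"
    thus ?thesis using mixed[OF st'' sym] by (simp only: dist_commute)
  qed
qed

lemma nontrivial_perfect_hexahedronI:
  fixes a b c d e f :: nat
  assumes pos: "a > 0" "b > 0" "c > 0" "d > 0" "e > 0" "f > 0" "h > 0"
    and c: "a\<^sup>2 + b\<^sup>2 = c\<^sup>2" and d: "d\<^sup>2 = e\<^sup>2 + a * b" and f: "f\<^sup>2 = d\<^sup>2 + a * b"
    and h: "(real c)\<^sup>2 + 2 * h\<^sup>2 = 2 * (real d)\<^sup>2"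
  shows "nontrivial_perfect_hexahedron (hexahedron (real a) (real b) h)"
proof -
  have "(real a)\<^sup>2 + (real b)\<^sup>2 = (real c)\<^sup>2" "(real d)\<^sup>2 = (real e)\<^sup>2 + real a * real b"
    "(real f)\<^sup>2 = (real d)\<^sup>2 + real a * real b"
    using c d f by (simp_all flip: of_nat_power of_nat_mult of_nat_add)
  note dists = distances_between_hexahedron_vertices[OF _ _ _ _ _ _ this h]
  show ?thesis
    unfolding nontrivial_perfect_hexahedron_def Let_def
  proof (rule exI[of _ a], rule exI[of _ b], rule exI[of _ c], rule exI[of _ d], rule exI[of _ e],
      rule exI[of _ f], rule exI[of _ h], intro conjI ballI)
  qed (use pos dists in simp_all)
qed

lemma height_of_tall_solution:
  fixes s d :: nat
  assumes "289 * s\<^sup>2 < 2 * d\<^sup>2"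
  defines "h \<equiv> sqrt ((real d)\<^sup>2 - 289 * (real s)\<^sup>2 / 2)"
  shows "h > 0" "(real (17 * s))\<^sup>2 + 2 * h\<^sup>2 = 2 * (real d)\<^sup>2"
proof -
  have "real (289 * s\<^sup>2) < real (2 * d\<^sup>2)" using assms(1) by (rule of_nat_less_iff[THEN iffD2])
  hence *: "(real d)\<^sup>2 - 289 * (real s)\<^sup>2 / 2 > 0" by simp
  thus "h > 0" by (simp add: h_def)
  have "h\<^sup>2 = (real d)\<^sup>2 - 289 * (real s)\<^sup>2 / 2" using * by (simp add: h_def)
  thus "(real (17 * s))\<^sup>2 + 2 * h\<^sup>2 = 2 * (real d)\<^sup>2" by (simp add: power_mult_distrib)
qed

text \<open>The height solves \<open>(17 * s)\<^sup>2 + 2 * h\<^sup>2 = 2 * d\<^sup>2\<close>, and the inequality makes it positive.\<close>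

definition perfect_at_level :: "nat \<Rightarrow> (real^3) set \<Rightarrow> bool" where
  "perfect_at_level n P \<longleftrightarrow>
     (\<exists>s d e f. scaled_solution n s d e f \<and> 289 * s\<^sup>2 < 2 * d\<^sup>2 \<and>
        P = hexahedron (real (8 * s)) (real (15 * s)) (sqrt ((real d)\<^sup>2 - 289 * (real s)\<^sup>2 / 2)))"

lemma perfect_at_level_hexahedron:
  assumes "perfect_at_level n P"
  shows "nontrivial_perfect_hexahedron P" "two_rectangles_four_trapezoids P"
proof -
  obtain s d e f h where sol: "scaled_solution n s d e f" and "289 * s\<^sup>2 < 2 * d\<^sup>2"
    and h_def: "h = sqrt ((real d)\<^sup>2 - 289 * (real s)\<^sup>2 / 2)"
    and P: "P = hexahedron (real (8 * s)) (real (15 * s)) h"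
    using assms by (auto simp: perfect_at_level_def)
  note h = height_of_tall_solution[OF \<open>289 * s\<^sup>2 < 2 * d\<^sup>2\<close>, folded h_def]
  show "nontrivial_perfect_hexahedron P"
    unfolding P
    using scaled_solution_pos[OF sol] h(1) scaled_solution_equations[OF sol] h(2)
    by (intro nontrivial_perfect_hexahedronI[of _ _ "17 * s"]) simp_all
  show "two_rectangles_four_trapezoids P"
    unfolding P using scaled_solution_pos[OF sol] h(1)
    by (intro two_rectangles_four_trapezoids_hexahedron) simp_all
qed

section \<open>Telling hexahedra apart up to similarity\<close>

text \<open>Betweenness is the equality case of the triangle inequality, hence a purely metric notion. This
  makes extreme points invariant under maps that are only known to scale distances.\<close>

lemma similarity_map_extreme_point_iff:
  assumes "similarity_map r g" and "x \<in> P"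
  shows "g x extreme_point_of g ` P \<longleftrightarrow> x extreme_point_of P"
proof -
  have r: "r > 0" and dist: "dist (g u) (g v) = r * dist u v" for u v
    using assms(1) by (auto simp: similarity_map_def)
  have eq: "g u = g v \<longleftrightarrow> u = v" for u v
    using dist[of u v] r by (metis dist_eq_0_iff mult_eq_0_iff less_irrefl)
  have seg: "g x \<in> open_segment (g u) (g v) \<longleftrightarrow> x \<in> open_segment u v" for u v
  proof -
    have "g x \<in> closed_segment (g u) (g v) \<longleftrightarrow> x \<in> closed_segment u v"
      unfolding between_mem_segment[symmetric] between dist
      using r by (simp flip: distrib_left)
    thus ?thesis by (simp add: open_segment_def eq)
  qed
  show ?thesis
    using assms(2) by (auto simp: extreme_point_of_def seg)
qed

text \<open>Up to a common factor, this set is a similarity invariant; it needs no matching of vertices.\<close>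

definition extreme_distances :: "(real^3) set \<Rightarrow> real set" where
  "extreme_distances P =
     {dist u v | u v. u extreme_point_of P \<and> v extreme_point_of P \<and> u \<noteq> v}"

lemma extreme_distances_similarity:
  assumes g: "similarity_map r g"
  shows "extreme_distances (g ` P) = (*) r ` extreme_distances P"
proof -
  have r: "r > 0" and dist: "dist (g u) (g v) = r * dist u v" for u v
    using g by (auto simp: similarity_map_def)
  have eq: "g u = g v \<longleftrightarrow> u = v" for u v
    using dist[of u v] r by (metis dist_eq_0_iff mult_eq_0_iff less_irrefl)
  have ext: "w extreme_point_of g ` P \<longleftrightarrow> (\<exists>u. w = g u \<and> u extreme_point_of P)" for w
  proof
    assume w: "w extreme_point_of g ` P"
    then obtain u where "u \<in> P" "w = g u" unfolding extreme_point_of_def by blast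
    thus "\<exists>u. w = g u \<and> u extreme_point_of P"
      using similarity_map_extreme_point_iff[OF g] w by blast
  next
    assume "\<exists>u. w = g u \<and> u extreme_point_of P"
    then obtain u where u: "w = g u" "u extreme_point_of P" by blast
    hence "u \<in> P" by (simp add: extreme_point_of_def)
    thus "w extreme_point_of g ` P"
      using similarity_map_extreme_point_iff[OF g] u by blast
  qed
  show ?thesis
  proof (intro equalityI subsetI)
    fix x assume "x \<in> extreme_distances (g ` P)"
    then obtain u v where "u extreme_point_of P" "v extreme_point_of P" "g u \<noteq> g v"
      and x: "x = dist (g u) (g v)"
      unfolding extreme_distances_def ext by blast
    hence "dist u v \<in> extreme_distances P" by (auto simp: extreme_distances_def)
    thus "x \<in> (*) r ` extreme_distances P" unfolding x dist by (rule imageI)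
  next
    fix x assume "x \<in> (*) r ` extreme_distances P"
    then obtain u v where "u extreme_point_of P" "v extreme_point_of P" "u \<noteq> v"
      and x: "x = r * dist u v"
      unfolding extreme_distances_def by blast
    moreover have "x = dist (g u) (g v)" "g u \<noteq> g v"
      using \<open>u \<noteq> v\<close> by (simp_all add: x dist eq)
    ultimately show "x \<in> extreme_distances (g ` P)"
      unfolding extreme_distances_def ext by blast
  qed
qed

text \<open>The distances are integers, one of them is odd, and the largest power of two dividing one of them
  is \<open>2 ^ (n + 3)\<close>.\<close>

lemma extreme_distances_at_level:
  assumes "perfect_at_level n P"
  obtains s d :: nat where "real d \<in> extreme_distances P" "odd d"
    "real (8 * s) \<in> extreme_distances P" "2 ^ (n + 3) dvd 8 * s"
    "\<And>x. x \<in> extreme_distances P \<Longrightarrow> \<exists>y. x = real y \<and> \<not> 2 ^ (n + 4) dvd y"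
proof -
  obtain s d e f h where sol: "scaled_solution n s d e f" and "289 * s\<^sup>2 < 2 * d\<^sup>2"
    and h_def: "h = sqrt ((real d)\<^sup>2 - 289 * (real s)\<^sup>2 / 2)"
    and P: "P = hexahedron (real (8 * s)) (real (15 * s)) h"
    using assms by (auto simp: perfect_at_level_def)
  note h = height_of_tall_solution[OF \<open>289 * s\<^sup>2 < 2 * d\<^sup>2\<close>, folded h_def]
  let ?a = "real (8 * s)" and ?b = "real (15 * s)" and ?c = "real (17 * s)"
  have pos: "?a > 0" "?b > 0" "h > 0" using scaled_solution_pos[OF sol] h by simp_all
  have ext: "v extreme_point_of P \<longleftrightarrow> v \<in> hexahedron_vertices ?a ?b h" for v
    using extreme_points_of_hexahedron[OF pos] P by blast
  have eqs: "?a\<^sup>2 + ?b\<^sup>2 = ?c\<^sup>2" "(real d)\<^sup>2 = (real e)\<^sup>2 + ?a * ?b" "(real f)\<^sup>2 = (real d)\<^sup>2 + ?a * ?b"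
    using scaled_solution_equations[OF sol]
    by (simp_all only: flip: of_nat_power of_nat_mult of_nat_add)
  have nonneg: "0 \<le> ?a" "0 \<le> ?b" "0 \<le> ?c" "0 \<le> real d" "0 \<le> real e" "0 \<le> real f" by simp_all
  note dists = distances_between_hexahedron_vertices[OF nonneg eqs h(2), of 1 1]
  have attained: "x \<in> extreme_distances P"
    if "u \<in> hexahedron_vertices ?a ?b h" "v \<in> hexahedron_vertices ?a ?b h" "dist u v = x" "x \<noteq> 0"
    for u v x
    using that ext unfolding extreme_distances_def by fastforce
  have "odd d" "2 ^ (n + 3) dvd 8 * s"
    using sol by (auto simp: scaled_solution_def power_add)
  moreover have "real d \<in> extreme_distances P"
    using scaled_solution_pos[OF sol]
    by (intro attained[OF _ _ dists(8)]) (simp_all add: hexahedron_vertices_explicit)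
  moreover have "?a \<in> extreme_distances P"
    using pos by (intro attained[OF _ _ dists(1)]) (simp_all add: hexahedron_vertices_explicit)
  moreover have "\<exists>y. x = real y \<and> \<not> 2 ^ (n + 4) dvd y" if x: "x \<in> extreme_distances P" for x
  proof -
    have "x \<in> {?a, ?b, ?c, real d, real e, real f}"
      using x vertex_distance_cases[OF nonneg eqs h(2)] unfolding extreme_distances_def ext by blast
    then obtain y where "y \<in> {8 * s, 15 * s, 17 * s, d, e, f}" "x = real y" by blast
    thus ?thesis using scaled_solution_dvd[OF sol] by blast
  qed
  ultimately show thesis using that by blast
qed

text \<open>The largest exponent of two in a ratio of two distances is \<open>n + 3\<close>: it is attained by \<open>8 * s\<close> over
  the odd length \<open>d\<close>. Ratios of distances are the same for similar solids.\<close>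

lemma similar_imp_same_level:
  assumes P: "perfect_at_level n P" and Q: "perfect_at_level m Q" and "similar_sets P Q"
  shows "n = m"
proof -
  obtain r g where g: "similarity_map r g" "Q = g ` P"
    using assms(3) by (auto simp: similar_sets_def)
  have D: "extreme_distances Q = (*) r ` extreme_distances P"
    using extreme_distances_similarity g by simp
  \<comment> \<open>If the ratio \<open>x1 / x2\<close> of two distances of one solid equals the ratio \<open>a / d\<close> of the two
    extremal distances of the other, then \<open>x1\<close> inherits the factor \<open>2 ^ (k + 3)\<close>.\<close>
  have key: "k + 3 < l + 4"
    if "real x1 * real d = real x2 * real a" "odd d" "2 ^ (k + 3) dvd a" "\<not> 2 ^ (l + 4) dvd x1"
    for k l x1 x2 d a :: nat
  proof (rule ccontr)
    assume "\<not> k + 3 < l + 4"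
    hence "2 ^ (l + 4) dvd a"
      using that(3) by (metis dvd_trans le_imp_power_dvd not_less)
    moreover have "x1 * d = x2 * a" using that(1) by (simp flip: of_nat_mult)
    ultimately have "2 ^ (l + 4) dvd x1 * d" by simp
    moreover have "coprime (2 ^ (l + 4)) d" using that(2) by simp
    ultimately have "2 ^ (l + 4) dvd x1" by (simp only: coprime_dvd_mult_left_iff)
    thus False using that(4) by simp
  qed
  obtain s d where p: "real d \<in> extreme_distances P" "odd d"
    "real (8 * s) \<in> extreme_distances P" "2 ^ (n + 3) dvd 8 * s"
    "\<And>x. x \<in> extreme_distances P \<Longrightarrow> \<exists>y. x = real y \<and> \<not> 2 ^ (n + 4) dvd y"
    using extreme_distances_at_level[OF P] by metis
  obtain s' d' where q: "real d' \<in> extreme_distances Q" "odd d'"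
    "real (8 * s') \<in> extreme_distances Q" "2 ^ (m + 3) dvd 8 * s'"
    "\<And>x. x \<in> extreme_distances Q \<Longrightarrow> \<exists>y. x = real y \<and> \<not> 2 ^ (m + 4) dvd y"
    using extreme_distances_at_level[OF Q] by metis
  have "n + 3 < m + 4"
  proof -
    have "r * real d \<in> extreme_distances Q" "r * real (8 * s) \<in> extreme_distances Q"
      using p D by auto
    then obtain y1 y2 where y: "r * real d = real y1" "r * real (8 * s) = real y2"
      "\<not> 2 ^ (m + 4) dvd y2" using q(5) by metis
    have "real y2 * real d = real y1 * real (8 * s)"
      unfolding y(1,2)[symmetric] by (simp only: ac_simps)
    thus ?thesis using p(2,4) y(3) by (rule key)
  qed
  moreover have "m + 3 < n + 4"
  proof -
    obtain x1 x2 where x: "x1 \<in> extreme_distances P" "real d' = r * x1"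
      "x2 \<in> extreme_distances P" "real (8 * s') = r * x2"
      using q(1,3) unfolding D by blast
    then obtain y1 y2 where y: "x1 = real y1" "x2 = real y2" "\<not> 2 ^ (n + 4) dvd y2"
      using p(5) by metis
    have "real y2 * real d' = real y1 * real (8 * s')"
      unfolding x(2,4) y(1,2) by (simp only: ac_simps)
    thus ?thesis using q(2,4) y(3) by (rule key)
  qed
  ultimately show ?thesis by simp
qed

lemma similar_sets_refl: "similar_sets P P"
  unfolding similar_sets_def similarity_map_def
  by (intro exI[of _ 1] exI[of _ "\<lambda>x. x"]) simp

section \<open>Infinitely many solutions and hexahedra\<close>

theorem theorem2:
  "infinite {(a::nat, b::nat, c::nat, d::nat, e::nat, f::nat).
      a > 0 \<and> b > 0 \<and> c > 0 \<and> d > 0 \<and> e > 0 \<and> f > 0 \<and>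
      a^2 + b^2 = c^2 \<and> d^2 = e^2 + a * b \<and> f^2 = d^2 + a * b}
   \<and> (\<exists>\<H>. infinite \<H> \<and>
        (\<forall>P\<in>\<H>. nontrivial_perfect_hexahedron P \<and> two_rectangles_four_trapezoids P) \<and>
        pairwise (\<lambda>P Q. \<not> similar_sets P Q) \<H>)" (is "infinite ?S \<and> ?hexahedra")
proof
  define A where "A = {n. \<exists>s d e f. scaled_solution n s d e f \<and> 289 * s\<^sup>2 < 2 * d\<^sup>2}"
  have A: "infinite A" unfolding A_def by (rule infinite_tall_levels)
  have "\<forall>n\<in>A. \<exists>q. \<exists>s d e f. q = (8 * s, 15 * s, 17 * s, d, e, f) \<and> scaled_solution n s d e f"
    by (auto simp: A_def)
  from bchoice[OF this] obtain q where q: "\<And>n. n \<in> A \<Longrightarrow>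
      \<exists>s d e f. q n = (8 * s, 15 * s, 17 * s, d, e, f) \<and> scaled_solution n s d e f"
    by blast
  \<comment> \<open>The first entry \<open>8 * s\<close> already determines the level.\<close>
  have "inj_on q A"
  proof (rule inj_onI)
    fix m n assume "m \<in> A" "n \<in> A" "q m = q n"
    then obtain s d e f where sol: "scaled_solution m s d e f" "scaled_solution n s d e f"
      using q[of m] q[of n] by auto
    have "k \<le> l" if "scaled_solution k s d e f" "scaled_solution l s d e f" for k l
    proof (rule ccontr)
      assume "\<not> k \<le> l"
      hence "(2::nat) ^ (l + 4) dvd 2 ^ (k + 3)" by (intro le_imp_power_dvd) simp
      also have "2 ^ (k + 3) dvd 8 * s"
        using that(1) by (auto simp: scaled_solution_def power_add)
      finally show False using scaled_solution_dvd[OF that(2), of "8 * s"] by simp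
    qed
    thus "m = n" using sol by (simp add: le_antisym)
  qed
  moreover have "q ` A \<subseteq> ?S"
  proof (rule image_subsetI)
    fix n assume "n \<in> A"
    then obtain s d e f where "q n = (8 * s, 15 * s, 17 * s, d, e, f)" "scaled_solution n s d e f"
      using q by blast
    thus "q n \<in> ?S"
      using scaled_solution_pos[of n s d e f] scaled_solution_equations[of n s d e f] by simp
  qed
  ultimately show "infinite ?S"
    using A finite_imageD[of q A] infinite_super[of "q ` A" ?S] by blast
  have "\<forall>n\<in>A. \<exists>P. perfect_at_level n P"
    unfolding A_def perfect_at_level_def by blast
  from bchoice[OF this] obtain P where P: "\<And>n. n \<in> A \<Longrightarrow> perfect_at_level n (P n)"
    by blast
  have same: "n = m" if "n \<in> A" "m \<in> A" "similar_sets (P n) (P m)" for n m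
    using similar_imp_same_level P that by metis
  have "inj_on P A"
  proof (rule inj_onI)
    fix n m assume "n \<in> A" "m \<in> A" "P n = P m"
    thus "n = m" using same similar_sets_refl[of "P n"] by simp
  qed
  hence "infinite (P ` A)" using A finite_imageD by blast
  moreover have "\<forall>H\<in>P ` A. nontrivial_perfect_hexahedron H \<and> two_rectangles_four_trapezoids H"
    using P perfect_at_level_hexahedron by blast
  moreover have "pairwise (\<lambda>H K. \<not> similar_sets H K) (P ` A)"
    unfolding pairwise_def using same by blast
  ultimately show ?hexahedra by blast
qed

end
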